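(* The sufficient condition SC-Adam is weaker than the sufficient condition SC-Zou: any real sequences $(\beta_k)_{k\ge1}$, $(\theta_k)_{k\ge1}$, $(\eta_k)_{k\ge1}$ with $\eta_k>0$ that satisfy SC-Zou also satisfy SC-Adam.
   Context: SC-Zou consists of the conditions: (z1) $0\le\beta_k\le\beta<1$ for all $k$, for some constant $\beta$; (z2) $0<\theta_k<1$ for all $k$ and $(\theta_k)$ is monotonically non-decreasing; (z3) there exist a non-increasing real sequence $(\alpha_k)_{k\ge1}$ and a constant $C>0$ such that $\alpha_k\le\eta_k/\sqrt{1-\theta_k}\le C\alpha_k$ for all $k\ge1$; (z4) $\big(\sum_{k=1}^{K}\eta_k\sqrt{1-\theta_k}\big)/(K\eta_K)=o(1)$ as $K\to\infty$. SC-Adam consists of the conditions: (1) $0\le\beta_k\le\beta<1$ for all $k$, for some constant $\beta$; (2) $0<\theta_k<1$ for all $k$; (3) there exist a non-increasing real sequence $(\alpha_k)_{k\ge1}$ and constants $C_0,\tilde C_0>0$ such that $C_0\alpha_k\le\eta_k\le\tilde C_0\alpha_k$ for all $k\ge1$; (4) $\big(\sum_{k=1}^{K}\eta_k(1-\theta_k)\big)/(K\eta_K)=o(1)$ as $K\to\infty$; (5) $\big(\sum_{k=1}^{K}\eta_k^2\big)/(K\eta_K)=o(1)$ as $K\to\infty$. *)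

theory Defs
  imports Complex_Main "HOL-Library.Landau_Symbols"
begin

text \<open>
  A sequence \<open>(x\<^sub>k)\<close> with \<open>k \<ge> 1\<close> is a function of type \<open>nat \<Rightarrow> real\<close> whose value
  at \<open>0\<close> is irrelevant: every condition is restricted to indices \<open>k \<ge> 1\<close> or is a
  statement about \<open>K \<rightarrow> \<infinity>\<close>.
\<close>

definition SC_Zou ::
  "(nat \<Rightarrow> real) \<Rightarrow> (nat \<Rightarrow> real) \<Rightarrow> (nat \<Rightarrow> real) \<Rightarrow> bool" where
  "SC_Zou \<beta> \<theta> \<eta> \<longleftrightarrow>
     (\<exists>b. b < 1 \<and> (\<forall>k\<ge>1. 0 \<le> \<beta> k \<and> \<beta> k \<le> b)) \<and>
     (\<forall>k\<ge>1. 0 < \<theta> k \<and> \<theta> k < 1) \<and> mono_on {1..} \<theta> \<and>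
     (\<exists>\<alpha>. \<exists>C>0. antimono_on {1..} \<alpha> \<and>
        (\<forall>k\<ge>1. \<alpha> k \<le> \<eta> k / sqrt (1 - \<theta> k) \<and> \<eta> k / sqrt (1 - \<theta> k) \<le> C * \<alpha> k)) \<and>
     (\<lambda>K. (\<Sum>k=1..K. \<eta> k * sqrt (1 - \<theta> k)) / (real K * \<eta> K)) \<in> o(\<lambda>_. 1)"

definition SC_Adam ::
  "(nat \<Rightarrow> real) \<Rightarrow> (nat \<Rightarrow> real) \<Rightarrow> (nat \<Rightarrow> real) \<Rightarrow> bool" where
  "SC_Adam \<beta> \<theta> \<eta> \<longleftrightarrow>
     (\<exists>b. b < 1 \<and> (\<forall>k\<ge>1. 0 \<le> \<beta> k \<and> \<beta> k \<le> b)) \<and>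
     (\<forall>k\<ge>1. 0 < \<theta> k \<and> \<theta> k < 1) \<and>
     (\<exists>\<alpha>. \<exists>C\<^sub>0>0. \<exists>C\<^sub>1>0. antimono_on {1..} \<alpha> \<and>
        (\<forall>k\<ge>1. C\<^sub>0 * \<alpha> k \<le> \<eta> k \<and> \<eta> k \<le> C\<^sub>1 * \<alpha> k)) \<and>
     (\<lambda>K. (\<Sum>k=1..K. \<eta> k * (1 - \<theta> k)) / (real K * \<eta> K)) \<in> o(\<lambda>_. 1) \<and>
     (\<lambda>K. (\<Sum>k=1..K. (\<eta> k)\<^sup>2) / (real K * \<eta> K)) \<in> o(\<lambda>_. 1)"

end

theory Submission
  imports Defs
begin

text \<open>
  Put \<open>s\<^sub>k = sqrt (1 - \<theta>\<^sub>k) \<in> (0, 1)\<close>, which is non-increasing. If \<open>\<alpha>\<close> witnesses (z3), then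
  \<open>\<alpha>\<^sub>k s\<^sub>k\<close> witnesses (3). Conditions (4) and (5) follow from (z4) by comparing numerators:
  \<open>1 - \<theta>\<^sub>k \<le> s\<^sub>k\<close>, and \<open>\<eta>\<^sub>k\<^sup>2 \<le> \<eta>\<^sub>k (C \<alpha>\<^sub>k s\<^sub>k) \<le> C \<alpha>\<^sub>1 \<eta>\<^sub>k s\<^sub>k\<close>.
\<close>

text \<open>A termwise bound passes to partial sums, and the common denominator is positive for
  \<open>K \<ge> 1\<close>, so one quotient is big-O of the other. This reduces both little-o claims
  to termwise inequalities.\<close>

lemma smallo_sum_quotient_mono:
  fixes f g \<eta> :: "nat \<Rightarrow> real"
  assumes \<eta>: "\<And>k. k \<ge> 1 \<Longrightarrow> \<eta> k > 0"
    and le: "\<And>k. k \<ge> 1 \<Longrightarrow> 0 \<le> f k \<and> f k \<le> c * g k"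
    and g: "(\<lambda>K. (\<Sum>k=1..K. g k) / (real K * \<eta> K)) \<in> o(h)"
  shows "(\<lambda>K. (\<Sum>k=1..K. f k) / (real K * \<eta> K)) \<in> o(h)"
proof (rule landau_o.big_small_trans[OF _ g])
  have "norm ((\<Sum>k=1..K. f k) / (real K * \<eta> K))
      \<le> \<bar>c\<bar> * norm ((\<Sum>k=1..K. g k) / (real K * \<eta> K))" if "K \<ge> 1" for K
  proof -
    have "0 \<le> (\<Sum>k=1..K. f k)" using le by (intro sum_nonneg) auto
    moreover have "(\<Sum>k=1..K. f k) \<le> c * (\<Sum>k=1..K. g k)"
      unfolding sum_distrib_left using le by (intro sum_mono) auto
    \<comment> \<open>Nonnegativity of the left sum turns the one-sided bound into one on norms; the
      absolute value of \<open>c\<close> appears because its sign is left open.\<close>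
    ultimately have "\<bar>\<Sum>k=1..K. f k\<bar> \<le> \<bar>c\<bar> * \<bar>\<Sum>k=1..K. g k\<bar>"
      unfolding abs_mult[symmetric] by linarith
    then show ?thesis
      using \<eta>[OF that] that by (simp add: abs_mult divide_right_mono)
  qed
  then show "(\<lambda>K. (\<Sum>k=1..K. f k) / (real K * \<eta> K))
      \<in> O(\<lambda>K. (\<Sum>k=1..K. g k) / (real K * \<eta> K))"
    by (intro bigoI[where c = "\<bar>c\<bar>"] eventually_sequentiallyI[of 1])
qed

theorem proposition24:
  fixes \<beta> \<theta> \<eta> :: "nat \<Rightarrow> real"
  assumes "\<And>k. k \<ge> 1 \<Longrightarrow> \<eta> k > 0"
    and "SC_Zou \<beta> \<theta> \<eta>"
  shows "SC_Adam \<beta> \<theta> \<eta>"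
proof -
  note pos = assms(1)
  define s where "s k = sqrt (1 - \<theta> k)" for k
  from assms(2) obtain \<alpha> C where
    beta: "\<exists>b. b < 1 \<and> (\<forall>k\<ge>1. 0 \<le> \<beta> k \<and> \<beta> k \<le> b)"
    and th: "\<forall>k\<ge>1. 0 < \<theta> k \<and> \<theta> k < 1" and mono: "mono_on {1..} \<theta>"
    and C: "C > 0" and \<alpha>: "antimono_on {1..} \<alpha>"
    and bounds: "\<And>k. k \<ge> 1 \<Longrightarrow> \<alpha> k \<le> \<eta> k / s k \<and> \<eta> k / s k \<le> C * \<alpha> k"
    and small: "(\<lambda>K. (\<Sum>k=1..K. \<eta> k * s k) / (real K * \<eta> K)) \<in> o(\<lambda>_. 1)"
    unfolding SC_Zou_def s_def by blast
  have s: "0 < s k" "s k \<le> 1" "(s k)\<^sup>2 = 1 - \<theta> k" if "k \<ge> 1" for k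
    using th that by (auto simp: s_def intro: less_imp_le)
  \<comment> \<open>Positivity of \<open>\<alpha>\<close> is forced by the upper bound, since
    \<open>\<eta> k / s k\<close> is positive. Without it, the product of the non-increasing factors
    \<open>\<alpha>\<close> and \<open>s\<close> could fail to be non-increasing.\<close>
  have \<alpha>_pos: "0 < \<alpha> k" if "k \<ge> 1" for k
  proof -
    have "0 < \<eta> k / s k" using pos[OF that] s[OF that] by simp
    with bounds[OF that] have "0 < C * \<alpha> k" by linarith
    with C show ?thesis by (simp add: zero_less_mult_iff)
  qed
  have \<eta>_bounds: "\<alpha> k * s k \<le> \<eta> k" "\<eta> k \<le> C * (\<alpha> k * s k)" if "k \<ge> 1" for k
    using bounds[OF that] s[OF that] by (simp_all add: field_simps)
  have "antimono_on {1..} (\<lambda>k. \<alpha> k * s k)"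
  proof (rule monotone_onI)
    fix i j :: nat
    assume ij: "i \<in> {1..}" "j \<in> {1..}" "i \<le> j"
    have "\<alpha> j \<le> \<alpha> i" using monotone_onD[OF \<alpha> ij] by simp
    moreover have "s j \<le> s i"
      unfolding s_def using monotone_onD[OF mono ij] by simp
    ultimately show "\<alpha> j * s j \<le> \<alpha> i * s i"
      using ij \<alpha>_pos[of i] s[of j] by (intro mult_mono) auto
  qed
  then have "\<exists>\<alpha>. \<exists>C\<^sub>0>0. \<exists>C\<^sub>1>0. antimono_on {1..} \<alpha> \<and>
      (\<forall>k\<ge>1. C\<^sub>0 * \<alpha> k \<le> \<eta> k \<and> \<eta> k \<le> C\<^sub>1 * \<alpha> k)"
    using \<eta>_bounds C
    by (intro exI[of _ "\<lambda>k. \<alpha> k * s k"] exI[of _ 1] exI[of _ C]) auto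
  moreover have "(\<lambda>K. (\<Sum>k=1..K. \<eta> k * (1 - \<theta> k)) / (real K * \<eta> K)) \<in> o(\<lambda>_. 1)"
  proof (rule smallo_sum_quotient_mono[OF pos _ small, where c = 1])
    fix k :: nat
    assume k: "k \<ge> 1"
    have "(s k)\<^sup>2 \<le> s k"
      using s(1,2)[OF k] by (simp add: power2_eq_square)
    then show "0 \<le> \<eta> k * (1 - \<theta> k) \<and> \<eta> k * (1 - \<theta> k) \<le> 1 * (\<eta> k * s k)"
      \<comment> \<open>Rewriting \<open>1 - \<theta> k\<close> as the square of \<open>s k\<close>
        and cancelling \<open>\<eta> k\<close> leaves the inequality just shown.\<close>
      using pos[OF k] by (simp flip: s(3)[OF k])
  qed
  moreover have "(\<lambda>K. (\<Sum>k=1..K. (\<eta> k)\<^sup>2) / (real K * \<eta> K)) \<in> o(\<lambda>_. 1)"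
  proof (rule smallo_sum_quotient_mono[OF pos _ small, where c = "C * \<alpha> 1"])
    fix k :: nat
    assume k: "k \<ge> 1"
    \<comment> \<open>Replacing \<open>\<alpha> k\<close> by its largest value makes the factor
      independent of \<open>k\<close>, as the constant \<open>c\<close> must be.\<close>
    have "\<alpha> k \<le> \<alpha> 1" using monotone_onD[OF \<alpha>, of 1 k] k by simp
    then have "C * (\<alpha> k * s k) \<le> C * (\<alpha> 1 * s k)"
      using C s[OF k] by simp
    with \<eta>_bounds[OF k] have "\<eta> k \<le> C * (\<alpha> 1 * s k)" by linarith
    then have "\<eta> k * \<eta> k \<le> \<eta> k * (C * (\<alpha> 1 * s k))"
      using pos[OF k] by simp
    then show "0 \<le> (\<eta> k)\<^sup>2 \<and> (\<eta> k)\<^sup>2 \<le> C * \<alpha> 1 * (\<eta> k * s k)"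
      by (simp add: power2_eq_square mult_ac)
  qed
  ultimately show ?thesis
    using beta th unfolding SC_Adam_def by blast
qed

end
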